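(* Let $G$ be a finite connected graph and let $R$ be a USP-relation on $E(G)$ with classes $\varphi_1,\dots,\varphi_n$. Then $$G/\mathcal P^R\;\cong\;G_{\varphi_1}/\mathcal P^R_{\overline{\varphi_1}}\;\Box\;\cdots\;\Box\;G_{\varphi_n}/\mathcal P^R_{\overline{\varphi_n}}.$$
   Context: $G$ is a finite connected simple graph. For $\varphi\subseteq E(G)$, $G_\varphi$ is the spanning subgraph of $G$ with vertex set $V(G)$ and edge set $\varphi$, $G_\varphi^x$ is the connected component of $G_\varphi$ containing $x$, and $\overline\varphi=E(G)\setminus\varphi$. A chordless square is an induced 4-cycle. An equivalence relation $Q$ on $E(G)$ has the unique square property if any two adjacent edges in distinct $Q$-classes are contained in exactly one chordless square whose opposite edges lie in the same $Q$-class. An equivalence relation $R$ on $E(G)$ is a USP-relation if some equivalence relation $Q\subseteq R$ has the unique square property. For an $R$-class $\varphi$, $\mathcal P^R_{\overline\varphi}=\{V(G^x_{\overline\varphi})\mid x\in V(G)\}$, a partition of $V(G)$; $V_R(x)=\bigcap_{\varphi\ R\text{-class}}V(G^x_{\overline\varphi})$ and $\mathcal P^R=\{V_R(x)\mid x\in V(G)\}$. For a graph $H$ and a partition $\mathcal P$ of $V(H)$, the quotient graph $H/\mathcal P$ has vertex set $\mathcal P$ and an (undirected) edge $[A,B]$, possibly a loop when $A=B$, iff there exist $a\in A$, $b\in B$ with $[a,b]\in E(H)$. The Cartesian product $X\Box Y$ of graphs (loops allowed) has vertex set $V(X)\times V(Y)$, with $(x_1,y_1)$ and $(x_2,y_2)$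 adjacent iff $[x_1,x_2]\in E(X)$ and $y_1=y_2$, or $[y_1,y_2]\in E(Y)$ and $x_1=x_2$. *)

theory Defs
  imports Main
begin

text \<open>An edge is the set of its end vertices: an edge [u,v] is \<open>{u, v}\<close>, and a loop at \<open>u\<close>
  is the singleton \<open>{u}\<close>, which equals \<open>{u, u}\<close>.\<close>

record 'a ugraph =
  verts :: "'a set"
  edges :: "'a set set"

definition simple_graph :: "'a ugraph \<Rightarrow> bool" where
  "simple_graph G \<longleftrightarrow>
     (\<forall>e\<in>edges G. \<exists>u\<in>verts G. \<exists>v\<in>verts G. u \<noteq> v \<and> e = {u, v})"

definition adj_rel :: "'a ugraph \<Rightarrow> ('a \<times> 'a) set" where
  "adj_rel G = {(u, v). {u, v} \<in> edges G}"

definition connected_graph :: "'a ugraph \<Rightarrow> bool" where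
  "connected_graph G \<longleftrightarrow>
     verts G \<noteq> {} \<and> (\<forall>u\<in>verts G. \<forall>v\<in>verts G. (u, v) \<in> (adj_rel G)\<^sup>*)"

definition spanning_subgraph :: "'a ugraph \<Rightarrow> 'a set set \<Rightarrow> 'a ugraph" where
  "spanning_subgraph G \<phi> = \<lparr>verts = verts G, edges = \<phi>\<rparr>"

definition induced_subgraph :: "'a ugraph \<Rightarrow> 'a set \<Rightarrow> 'a ugraph" where
  "induced_subgraph G W = \<lparr>verts = W, edges = {e \<in> edges G. e \<subseteq> W}\<rparr>"

definition component :: "'a ugraph \<Rightarrow> 'a \<Rightarrow> 'a ugraph" where
  "component G x = induced_subgraph G {y \<in> verts G. (x, y) \<in> (adj_rel G)\<^sup>*}"

definition is_square :: "'a ugraph \<Rightarrow> bool" where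
  "is_square S \<longleftrightarrow>
     (\<exists>a b c d. distinct [a, b, c, d] \<and>
        S = \<lparr>verts = {a, b, c, d}, edges = {{a, b}, {b, c}, {c, d}, {d, a}}\<rparr>)"

definition chordless_square :: "'a ugraph \<Rightarrow> 'a ugraph \<Rightarrow> bool" where
  "chordless_square G S \<longleftrightarrow>
     is_square S \<and> verts S \<subseteq> verts G \<and> S = induced_subgraph G (verts S)"

text \<open>Two distinct edges of a simple graph are adjacent iff they meet, and two edges of a square
  are opposite iff they are disjoint. Uniqueness is required among the chordless squares
  whose opposite edges are \<open>Q\<close>-related, not among all chordless squares through \<open>e\<close> and \<open>f\<close>.\<close>

definition unique_square_property :: "'a ugraph \<Rightarrow> ('a set \<times> 'a set) set \<Rightarrow> bool" where
  "unique_square_property G Q \<longleftrightarrow>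
     (\<forall>e\<in>edges G. \<forall>f\<in>edges G. e \<noteq> f \<and> e \<inter> f \<noteq> {} \<and> (e, f) \<notin> Q \<longrightarrow>
        (\<exists>!S. chordless_square G S \<and> e \<in> edges S \<and> f \<in> edges S \<and>
              (\<forall>e'\<in>edges S. \<forall>f'\<in>edges S. e' \<inter> f' = {} \<longrightarrow> (e', f') \<in> Q)))"

definition usp_relation :: "'a ugraph \<Rightarrow> ('a set \<times> 'a set) set \<Rightarrow> bool" where
  "usp_relation G R \<longleftrightarrow>
     equiv (edges G) R \<and>
     (\<exists>Q. equiv (edges G) Q \<and> Q \<subseteq> R \<and> unique_square_property G Q)"

definition class_partition :: "'a ugraph \<Rightarrow> 'a set set \<Rightarrow> 'a set set" where
  "class_partition G \<phi> =
     {verts (component (spanning_subgraph G (edges G - \<phi>)) x) | x. x \<in> verts G}"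

text \<open>The outer \<open>verts G \<inter>\<close> only matters if there are no classes: the empty intersection is to be
  taken inside \<open>verts G\<close>.\<close>

definition rel_block :: "'a ugraph \<Rightarrow> ('a set \<times> 'a set) set \<Rightarrow> 'a \<Rightarrow> 'a set" where
  "rel_block G R x =
     verts G \<inter> (\<Inter>\<phi>\<in>edges G // R. verts (component (spanning_subgraph G (edges G - \<phi>)) x))"

definition rel_partition :: "'a ugraph \<Rightarrow> ('a set \<times> 'a set) set \<Rightarrow> 'a set set" where
  "rel_partition G R = {rel_block G R x | x. x \<in> verts G}"

definition quotient_graph :: "'a ugraph \<Rightarrow> 'a set set \<Rightarrow> 'a set ugraph" where
  "quotient_graph H P =
     \<lparr>verts = P,
      edges = {{A, B} | A B. A \<in> P \<and> B \<in> P \<and> (\<exists>a\<in>A. \<exists>b\<in>B. {a, b} \<in> edges H)}\<rparr>"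

definition cart_prod :: "'a ugraph \<Rightarrow> 'b ugraph \<Rightarrow> ('a \<times> 'b) ugraph" where
  "cart_prod X Y =
     \<lparr>verts = verts X \<times> verts Y,
      edges = {{(x1, y1), (x2, y2)} | x1 y1 x2 y2.
                 (x1, y1) \<in> verts X \<times> verts Y \<and> (x2, y2) \<in> verts X \<times> verts Y \<and>
                 ({x1, x2} \<in> edges X \<and> y1 = y2 \<or> {y1, y2} \<in> edges Y \<and> x1 = x2)}\<rparr>"

definition map_graph :: "('a \<Rightarrow> 'b) \<Rightarrow> 'a ugraph \<Rightarrow> 'b ugraph" where
  "map_graph h X = \<lparr>verts = h ` verts X, edges = (\<lambda>e. h ` e) ` edges X\<rparr>"

text \<open>The iterated Cartesian product, with a nested tuple \<open>(x\<^sub>1, (x\<^sub>2, \<dots>))\<close> stored as the list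
  \<open>[x\<^sub>1, x\<^sub>2, \<dots>]\<close> so that all numbers of factors share one type. The empty product is the
  loopless one-vertex graph, the unit of the Cartesian product.\<close>

primrec cart_prod_list :: "'a ugraph list \<Rightarrow> 'a list ugraph" where
  "cart_prod_list [] = \<lparr>verts = {[]}, edges = {}\<rparr>"
| "cart_prod_list (X # Xs) = map_graph (\<lambda>(x, xs). x # xs) (cart_prod X (cart_prod_list Xs))"

definition graph_iso :: "'a ugraph \<Rightarrow> 'b ugraph \<Rightarrow> bool" (infix "\<cong>" 50) where
  "G \<cong> H \<longleftrightarrow>
     (\<exists>h. bij_betw h (verts G) (verts H) \<and>
          (\<forall>u\<in>verts G. \<forall>v\<in>verts G. {u, v} \<in> edges G \<longleftrightarrow> {h u, h v} \<in> edges H))"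

lemma verts_cart_prod_list:
  "verts (cart_prod_list Xs) = {xs. list_all2 (\<lambda>x X. x \<in> verts X) xs Xs}"
proof (induction Xs)
  case (Cons X Xs)
  then show ?case
    by (auto simp: map_graph_def cart_prod_def list_all2_Cons2 image_iff)
qed simp

lemma edge_cart_prod_iff:
  "{p, q} \<in> edges (cart_prod X Y) \<longleftrightarrow>
     p \<in> verts X \<times> verts Y \<and> q \<in> verts X \<times> verts Y \<and>
     ({fst p, fst q} \<in> edges X \<and> snd p = snd q \<or> {snd p, snd q} \<in> edges Y \<and> fst p = fst q)"
  by (cases p; cases q) (auto simp: cart_prod_def doubleton_eq_iff insert_commute)

lemma edge_cart_prod_list_Cons_iff:
  "{x # xs, y # ys} \<in> edges (cart_prod_list (X # Xs)) \<longleftrightarrow>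
     {(x, xs), (y, ys)} \<in> edges (cart_prod X (cart_prod_list Xs))"
proof -
  let ?h = "\<lambda>(x, xs). x # xs"
  have "inj ?h" by (auto simp: inj_def)
  then have "inj ((`) ?h)" by (simp add: inj_image_eq_iff inj_def)
  then have "?h ` {(x, xs), (y, ys)} \<in> (`) ?h ` edges (cart_prod X (cart_prod_list Xs)) \<longleftrightarrow>
      {(x, xs), (y, ys)} \<in> edges (cart_prod X (cart_prod_list Xs))"
    by (rule inj_image_mem_iff)
  then show ?thesis
    by (simp add: map_graph_def)
qed

end

(*
  A vertex block is sent to the tuple of the components that contain it, one for each class.
  A square with opposite edges in the same class does two things. Completing it lets an edge of
  a class be transported along any path that avoids the class, so an edge of the product
  lifts to the quotient of G. Swapping the two edges of a path through it turns any path
  into one that first avoids a given class and then stays inside the class, so the components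
  for the different classes can be hit simultaneously.
*)
theory Submission
  imports Defs
begin

section \<open>Squares, and edges of iterated products\<close>

lemma is_square_opposite_corner:
  assumes "is_square S" "{a, b} \<in> edges S" "{a, c} \<in> edges S" "b \<noteq> c"
  shows "\<exists>d. {c, d} \<in> edges S \<and> {b, d} \<in> edges S \<and>
    {a, b} \<inter> {c, d} = {} \<and> {a, c} \<inter> {b, d} = {}"
proof -
  obtain p q r s where d: "distinct [p, q, r, s]"
    and S: "edges S = {{p, q}, {q, r}, {r, s}, {s, p}}"
    using assms(1) unfolding is_square_def by auto
  \<comment> \<open>The two neighbours of a corner of a square are fixed, so only the position of
    \<open>a\<close> varies; \<open>d\<close> is the corner opposite to \<open>a\<close>.\<close>
  consider "a = p" "{b, c} = {q, s}" | "a = q" "{b, c} = {p, r}"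
    | "a = r" "{b, c} = {q, s}" | "a = s" "{b, c} = {p, r}"
    using assms(2-4) d unfolding S by (auto simp: doubleton_eq_iff)
  then show ?thesis
  proof cases
    case 1 then show ?thesis using d unfolding S
      by (intro exI[of _ r]) (auto simp: doubleton_eq_iff)
  next
    case 2 then show ?thesis using d unfolding S
      by (intro exI[of _ s]) (auto simp: doubleton_eq_iff)
  next
    case 3 then show ?thesis using d unfolding S
      by (intro exI[of _ p]) (auto simp: doubleton_eq_iff)
  next
    case 4 then show ?thesis using d unfolding S
      by (intro exI[of _ q]) (auto simp: doubleton_eq_iff)
  qed
qed

text \<open>Tuples are given by functions on a distinct index list, so that
  \<open>set is - {i}\<close> is exactly the set of other coordinates. By induction: an edge either
  moves the first coordinate and fixes the rest, or fixes the first and moves the rest.\<close>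

lemma edge_cart_prod_list_map_iff:
  assumes "distinct is" "\<And>i. i \<in> set is \<Longrightarrow> f i \<in> verts (X i)"
    "\<And>i. i \<in> set is \<Longrightarrow> g i \<in> verts (X i)"
  shows "{map f is, map g is} \<in> edges (cart_prod_list (map X is)) \<longleftrightarrow>
    (\<exists>i\<in>set is. {f i, g i} \<in> edges (X i) \<and> (\<forall>j\<in>set is - {i}. f j = g j))"
  using assms
proof (induction "is")
  case (Cons i "is")
  have "map f is \<in> verts (cart_prod_list (map X is))"
    "map g is \<in> verts (cart_prod_list (map X is))"
    using Cons.prems by (auto simp: verts_cart_prod_list list_all2_conv_all_nth)
  then have "{map f (i # is), map g (i # is)} \<in> edges (cart_prod_list (map X (i # is))) \<longleftrightarrow>
      {f i, g i} \<in> edges (X i) \<and> map f is = map g is \<or>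
      {map f is, map g is} \<in> edges (cart_prod_list (map X is)) \<and> f i = g i"
    using Cons.prems by (simp only: list.map edge_cart_prod_list_Cons_iff edge_cart_prod_iff) auto
  moreover have "{map f is, map g is} \<in> edges (cart_prod_list (map X is)) \<longleftrightarrow>
    (\<exists>i\<in>set is. {f i, g i} \<in> edges (X i) \<and> (\<forall>j\<in>set is - {i}. f j = g j))"
    using Cons by simp
  moreover have "set (i # is) - {i} = set is"
    "\<And>k. k \<in> set is \<Longrightarrow> set (i # is) - {k} = insert i (set is - {k})"
    using Cons.prems by auto
  ultimately show ?case
    by (simp add: conj_commute cong: bex_cong) blast
qed simp

section \<open>Components after removal of one class\<close>

definition off_class :: "'a ugraph \<Rightarrow> 'a set set \<Rightarrow> ('a \<times> 'a) set" where
  "off_class G \<phi> = {(u, v). {u, v} \<in> edges G - \<phi>}"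

text \<open>The term is copied from \<open>class_partition\<close> and \<open>rel_block\<close>, so
  that both can be folded into it.\<close>

definition off_component :: "'a ugraph \<Rightarrow> 'a set set \<Rightarrow> 'a \<Rightarrow> 'a set" where
  "off_component G \<phi> x = verts (component (spanning_subgraph G (edges G - \<phi>)) x)"

lemma off_component_eq: "off_component G \<phi> x = {y \<in> verts G. (x, y) \<in> (off_class G \<phi>)\<^sup>*}"
  by (simp add: off_component_def component_def induced_subgraph_def spanning_subgraph_def
      adj_rel_def off_class_def)

lemma off_class_rtrancl_sym: "(x, y) \<in> (off_class G \<phi>)\<^sup>* \<Longrightarrow> (y, x) \<in> (off_class G \<phi>)\<^sup>*"
  by (rule symD[OF sym_rtrancl]) (auto simp: sym_def off_class_def insert_commute)

text \<open>Coordinates are compared as sets, whereas the arguments build paths; symmetry of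
  reachability links the two.\<close>

lemma off_component_eq_iff:
  assumes "x \<in> verts G" "y \<in> verts G"
  shows "off_component G \<phi> x = off_component G \<phi> y \<longleftrightarrow> (x, y) \<in> (off_class G \<phi>)\<^sup>*"
proof
  assume "off_component G \<phi> x = off_component G \<phi> y"
  then have "y \<in> off_component G \<phi> x"
    using assms by (simp add: off_component_eq)
  then show "(x, y) \<in> (off_class G \<phi>)\<^sup>*"
    by (simp add: off_component_eq)
next
  assume xy: "(x, y) \<in> (off_class G \<phi>)\<^sup>*"
  then have yx: "(y, x) \<in> (off_class G \<phi>)\<^sup>*"
    by (rule off_class_rtrancl_sym)
  show "off_component G \<phi> x = off_component G \<phi> y"
    unfolding off_component_eq using rtrancl_trans[OF xy] rtrancl_trans[OF yx] by blast
qed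

lemma mem_off_component_iff:
  assumes "x \<in> verts G"
  shows "y \<in> off_component G \<phi> x \<longleftrightarrow> y \<in> verts G \<and> off_component G \<phi> x = off_component G \<phi> y"
proof (cases "y \<in> verts G")
  case True
  then show ?thesis
    by (simp add: off_component_eq_iff[OF assms True]) (simp add: off_component_eq)
qed (simp add: off_component_eq)

section \<open>Moving edges and paths across squares\<close>

locale usp_graph =
  fixes G :: "'a ugraph" and R :: "('a set \<times> 'a set) set"
  assumes simple: "simple_graph G" and conn: "connected_graph G" and usp: "usp_relation G R"
begin

lemma equiv_R: "equiv (edges G) R"
  using usp by (simp add: usp_relation_def)

lemma class_subset: "\<phi> \<in> edges G // R \<Longrightarrow> \<phi> \<subseteq> edges G"
  using equiv_R by (metis Union_quotient Union_upper)

lemma class_disjoint: "\<phi> \<in> edges G // R \<Longrightarrow> \<psi> \<in> edges G // R \<Longrightarrow> \<phi> \<noteq> \<psi> \<Longrightarrow> \<phi> \<inter> \<psi> = {}"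
  using quotient_disj[OF equiv_R] by blast

lemma edge_verts: "{u, v} \<in> edges G \<Longrightarrow> u \<in> verts G \<and> v \<in> verts G"
  using simple unfolding simple_graph_def by (metis doubleton_eq_iff)

text \<open>A class of \<open>R\<close> is closed under \<open>Q\<close>, as
  \<open>Q \<subseteq> R\<close>. Hence the two edges at \<open>a\<close> are not
  \<open>Q\<close>-related and span a square, and opposite edges of it lie on the same side of
  \<open>\<phi>\<close>. The square property enters the proof only here.\<close>

lemma square_completion:
  assumes \<phi>: "\<phi> \<in> edges G // R" and ab: "{a, b} \<in> \<phi>" and ac: "{a, c} \<in> edges G - \<phi>"
  obtains d where "{c, d} \<in> \<phi>" "{b, d} \<in> edges G - \<phi>"
proof -
  obtain Q where Q: "equiv (edges G) Q" "Q \<subseteq> R" "unique_square_property G Q"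
    using usp by (auto simp: usp_relation_def)
  have closed: "e \<in> \<phi> \<longleftrightarrow> f \<in> \<phi>" if "(e, f) \<in> Q" for e f
  proof -
    have ef: "(e, f) \<in> R"
      using that Q(2) by blast
    moreover have "(f, e) \<in> R"
      using ef equiv_R by (simp add: equiv_def symD)
    ultimately show ?thesis
      using in_quotient_imp_closed[OF equiv_R \<phi>] by blast
  qed
  have abG: "{a, b} \<in> edges G"
    using ab class_subset[OF \<phi>] by blast
  have ne: "{a, b} \<noteq> {a, c}" and nQ: "({a, b}, {a, c}) \<notin> Q"
    using ab ac closed by auto
  have "\<exists>S. chordless_square G S \<and> {a, b} \<in> edges S \<and> {a, c} \<in> edges S \<and>
      (\<forall>e\<in>edges S. \<forall>f\<in>edges S. e \<inter> f = {} \<longrightarrow> (e, f) \<in> Q)"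
    using Q(3)[unfolded unique_square_property_def, THEN bspec, THEN bspec, THEN mp,
        of "{a, b}" "{a, c}"] abG ac ne nQ by (intro ex1_implies_ex) simp
  then obtain S where S: "chordless_square G S" "{a, b} \<in> edges S" "{a, c} \<in> edges S"
    and opp: "\<forall>e\<in>edges S. \<forall>f\<in>edges S. e \<inter> f = {} \<longrightarrow> (e, f) \<in> Q"
    by (elim exE conjE)
  have "S = induced_subgraph G (verts S)"
    using S(1) by (simp add: chordless_square_def)
  then have "edges S = {e \<in> edges G. e \<subseteq> verts S}"
    by (metis induced_subgraph_def ugraph.select_convs(2))
  then have sub: "edges S \<subseteq> edges G"
    by blast
  have "is_square S"
    using S(1) by (simp add: chordless_square_def)
  then obtain d where d: "{c, d} \<in> edges S" "{b, d} \<in> edges S"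
    "{a, b} \<inter> {c, d} = {}" "{a, c} \<inter> {b, d} = {}"
    using is_square_opposite_corner[of S a b c] S ne by blast
  have "{c, d} \<in> \<phi>"
    using closed[OF opp[rule_format, OF S(2) d(1,3)]] ab by simp
  moreover have "{b, d} \<in> edges G - \<phi>"
    using closed[OF opp[rule_format, OF S(3) d(2,4)]] ac d(2) sub by blast
  ultimately show thesis ..
qed

text \<open>Each step of the path off \<open>\<phi>\<close> completes a square with the current
  \<open>\<phi>\<close>-edge. The opposite edge is the next \<open>\<phi>\<close>-edge, and its far
  end moves along the fourth side, which is again off \<open>\<phi>\<close>.\<close>

lemma transport_edge:
  assumes \<phi>: "\<phi> \<in> edges G // R" and "(x, y) \<in> (off_class G \<phi>)\<^sup>*" "{x, b} \<in> \<phi>"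
  shows "\<exists>z. {y, z} \<in> \<phi> \<and> (b, z) \<in> (off_class G \<phi>)\<^sup>*"
  using assms(2)
proof (induction rule: rtrancl_induct)
  case base
  then show ?case using assms(3) by blast
next
  case (step y y')
  then obtain z where z: "{y, z} \<in> \<phi>" "(b, z) \<in> (off_class G \<phi>)\<^sup>*"
    by blast
  obtain d where "{y', d} \<in> \<phi>" "{z, d} \<in> edges G - \<phi>"
    using square_completion[OF \<phi> z(1)] step.hyps(2) unfolding off_class_def by blast
  then show ?case
    using z(2) by (auto simp: off_class_def intro: rtrancl_into_rtrancl)
qed

text \<open>The edge off \<open>\<phi>\<close> at the end of a path inside \<open>\<phi>\<close> is
  pushed to the front, one square for each edge of that path.\<close>

lemma swap_off_edge:
  assumes \<phi>: "\<phi> \<in> edges G // R" and "(w, v) \<in> {(u, v). {u, v} \<in> \<phi>}\<^sup>*" "(v, v') \<in> off_class G \<phi>"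
  shows "\<exists>w'. (w, w') \<in> off_class G \<phi> \<and> (w', v') \<in> {(u, v). {u, v} \<in> \<phi>}\<^sup>*"
  using assms(2)
proof (induction rule: converse_rtrancl_induct)
  case base
  then show ?case using assms(3) by blast
next
  case (step w u)
  then obtain z where z: "(u, z) \<in> off_class G \<phi>" "(z, v') \<in> {(u, v). {u, v} \<in> \<phi>}\<^sup>*"
    by blast
  \<comment> \<open>The route \<open>w\<close>, \<open>u\<close>, \<open>z\<close> uses
    \<open>\<phi>\<close> first; through the opposite corner \<open>d\<close> it uses
    \<open>\<phi>\<close> last.\<close>
  obtain d where "{z, d} \<in> \<phi>" "{w, d} \<in> edges G - \<phi>"
    using square_completion[OF \<phi>, of u w z] step.hyps(1) z(1)
    by (auto simp: off_class_def insert_commute)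
  then show ?case
    using z(2) by (auto simp: off_class_def insert_commute intro: converse_rtrancl_into_rtrancl)
qed

text \<open>A path from \<open>u\<close> to \<open>v\<close> is sorted edge by edge: a new edge in
  \<open>\<phi>\<close> is appended, any other is swapped past the inside part and lengthens the
  first part.\<close>

lemma off_then_inside:
  assumes \<phi>: "\<phi> \<in> edges G // R" and "u \<in> verts G" "v \<in> verts G"
  shows "\<exists>w. (u, w) \<in> (off_class G \<phi>)\<^sup>* \<and> (w, v) \<in> {(u, v). {u, v} \<in> \<phi>}\<^sup>*"
proof -
  have "(u, v) \<in> (adj_rel G)\<^sup>*"
    using conn assms by (simp add: connected_graph_def)
  then show ?thesis
  proof (induction rule: rtrancl_induct)
    case (step v v')
    then obtain w where w: "(u, w) \<in> (off_class G \<phi>)\<^sup>*" "(w, v) \<in> {(u, v). {u, v} \<in> \<phi>}\<^sup>*"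
      by blast
    show ?case
    proof (cases "{v, v'} \<in> \<phi>")
      case True
      then show ?thesis
        using w by (blast intro: rtrancl_into_rtrancl)
    next
      case False
      then have "(v, v') \<in> off_class G \<phi>"
        using step.hyps(2) by (simp add: adj_rel_def off_class_def)
      then show ?thesis
        using swap_off_edge[OF \<phi> w(2)] w(1) by (blast intro: rtrancl_into_rtrancl)
    qed
  qed blast
qed

text \<open>Classes are disjoint, so moving inside one class never leaves a component belonging to
  another.\<close>

lemma inside_off_component:
  assumes "\<phi> \<in> edges G // R" "\<psi> \<in> edges G // R" "\<phi> \<noteq> \<psi>" "(u, v) \<in> {(u, v). {u, v} \<in> \<phi>}\<^sup>*"
  shows "(u, v) \<in> (off_class G \<psi>)\<^sup>*"
proof -
  have "{(u, v). {u, v} \<in> \<phi>} \<subseteq> off_class G \<psi>"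
    using class_disjoint[OF assms(1-3)] class_subset[OF assms(1)] by (auto simp: off_class_def)
  then show ?thesis
    using assms(4) rtrancl_mono by blast
qed

section \<open>Meeting prescribed components simultaneously\<close>

lemma off_class_verts: "(u, v) \<in> (off_class G \<phi>)\<^sup>* \<Longrightarrow> u \<in> verts G \<Longrightarrow> v \<in> verts G"
  by (induction rule: rtrancl_induct) (auto simp: off_class_def dest: edge_verts)

text \<open>This yields surjectivity onto the product. Classes are added one at a time: the vertex
  \<open>u\<close> found for the others is moved inside the new class \<open>\<phi>\<close> to a
  vertex in the component of \<open>x \<phi>\<close>, which keeps it in its components for the other
  classes.\<close>

lemma common_vertex:
  assumes "distinct \<phi>s" "set \<phi>s \<subseteq> edges G // R"
    and "\<And>\<phi>. \<phi> \<in> set \<phi>s \<Longrightarrow> x \<phi> \<in> verts G"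
  shows "\<exists>w\<in>verts G. \<forall>\<phi>\<in>set \<phi>s. (x \<phi>, w) \<in> (off_class G \<phi>)\<^sup>*"
  using assms
proof (induction \<phi>s)
  case Nil
  then show ?case using conn by (auto simp: connected_graph_def)
next
  case (Cons \<phi> \<phi>s)
  then obtain u where u: "u \<in> verts G" "\<forall>\<psi>\<in>set \<phi>s. (x \<psi>, u) \<in> (off_class G \<psi>)\<^sup>*"
    by auto
  obtain w where w: "(x \<phi>, w) \<in> (off_class G \<phi>)\<^sup>*" "(w, u) \<in> {(u, v). {u, v} \<in> \<phi>}\<^sup>*"
    using off_then_inside[of \<phi> "x \<phi>" u] Cons.prems u by auto
  have "(x \<psi>, w) \<in> (off_class G \<psi>)\<^sup>*" if "\<psi> \<in> set \<phi>s" for \<psi>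
  proof -
    have "(w, u) \<in> (off_class G \<psi>)\<^sup>*"
      using inside_off_component[OF _ _ _ w(2)] Cons.prems that by auto
    then have "(u, w) \<in> (off_class G \<psi>)\<^sup>*"
      by (rule off_class_rtrancl_sym)
    then show ?thesis
      using bspec[OF u(2) that] by (rule rtrancl_trans[rotated])
  qed
  then show ?case
    using w(1) off_class_verts[OF w(1)] Cons.prems by auto
qed

section \<open>Adjacency in the factors and in the quotient\<close>

lemma mem_rel_block_iff:
  assumes "x \<in> verts G"
  shows "y \<in> rel_block G R x \<longleftrightarrow>
    y \<in> verts G \<and> (\<forall>\<phi>\<in>edges G // R. off_component G \<phi> x = off_component G \<phi> y)"
  unfolding rel_block_def off_component_def[symmetric]
  using mem_off_component_iff[OF assms] by auto

text \<open>An edge of the quotient is witnessed by arbitrary members of the two components;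
  transport replaces it by an edge starting at the given \<open>x\<close>.\<close>

lemma edge_factor_iff:
  assumes "x \<in> verts G" "y \<in> verts G" and \<phi>: "\<phi> \<in> edges G // R"
  shows "{off_component G \<phi> x, off_component G \<phi> y}
      \<in> edges (quotient_graph (spanning_subgraph G \<phi>) (class_partition G \<phi>)) \<longleftrightarrow>
    (\<exists>z. {x, z} \<in> \<phi> \<and> off_component G \<phi> y = off_component G \<phi> z)"
    (is "?E \<longleftrightarrow> ?Z")
proof
  assume ?E
  then obtain A B a b where AB: "{off_component G \<phi> x, off_component G \<phi> y} = {A, B}"
    and ab: "a \<in> A" "b \<in> B" "{a, b} \<in> \<phi>"
    by (auto simp: quotient_graph_def spanning_subgraph_def)
  then obtain a b where ab: "a \<in> off_component G \<phi> x" "b \<in> off_component G \<phi> y" "{a, b} \<in> \<phi>"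
    by (metis doubleton_eq_iff insert_commute)
  then have "(a, x) \<in> (off_class G \<phi>)\<^sup>*" "(y, b) \<in> (off_class G \<phi>)\<^sup>*"
    by (auto simp: off_component_eq intro: off_class_rtrancl_sym)
  \<comment> \<open>The path from \<open>a\<close> to \<open>x\<close> carries \<open>{a, b}\<close>
    to \<open>{x, z}\<close>, and \<open>z\<close> stays in the component of \<open>b\<close>, which
    is that of \<open>y\<close>.\<close>
  then obtain z where "{x, z} \<in> \<phi>" "(y, z) \<in> (off_class G \<phi>)\<^sup>*"
    using transport_edge[OF \<phi> _ ab(3)] by (blast intro: rtrancl_trans)
  then show ?Z
    using assms off_class_verts off_component_eq_iff by metis
next
  assume ?Z
  then obtain z where z: "{x, z} \<in> \<phi>" "off_component G \<phi> y = off_component G \<phi> z"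
    by blast
  then have "z \<in> verts G"
    using class_subset[OF \<phi>] edge_verts by blast
  then have "x \<in> off_component G \<phi> x" "z \<in> off_component G \<phi> y"
    using assms z by (auto simp: off_component_eq)
  then show ?E
    using z(1) assms
    by (auto simp: quotient_graph_def spanning_subgraph_def class_partition_def
        off_component_def[unfolded spanning_subgraph_def])
qed

text \<open>The right-hand side is adjacency of the component tuples in the product. An edge of
  \<open>G\<close> lies in one class and changes no component for the others; conversely, a factor
  edge lifts to an edge at \<open>x\<close> whose other end lies in the block of
  \<open>y\<close>.\<close>

lemma edge_rel_partition_iff:
  assumes x: "x \<in> verts G" and y: "y \<in> verts G"
  shows "{rel_block G R x, rel_block G R y} \<in> edges (quotient_graph G (rel_partition G R)) \<longleftrightarrow>
    (\<exists>\<phi>\<in>edges G // R.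
      {off_component G \<phi> x, off_component G \<phi> y}
        \<in> edges (quotient_graph (spanning_subgraph G \<phi>) (class_partition G \<phi>)) \<and>
      (\<forall>\<psi>\<in>edges G // R - {\<phi>}. off_component G \<psi> x = off_component G \<psi> y))"
    (is "?E \<longleftrightarrow> (\<exists>\<phi>\<in>_. ?F \<phi> \<and> ?S \<phi>)")
proof -
  have step: "off_component G \<psi> a = off_component G \<psi> b"
    if "{a, b} \<in> \<phi>" "\<phi> \<in> edges G // R" "\<psi> \<in> edges G // R - {\<phi>}" for a b \<phi> \<psi>
  proof -
    have "{a, b} \<in> edges G"
      using that class_subset by blast
    moreover have "(a, b) \<in> (off_class G \<psi>)\<^sup>*"
      using inside_off_component[of \<phi> \<psi> a b] that by blast
    ultimately show ?thesis
      using off_component_eq_iff edge_verts by metis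
  qed
  show ?thesis
  proof
    assume ?E
    then obtain A B a b where AB: "{rel_block G R x, rel_block G R y} = {A, B}"
      and ab: "a \<in> A" "b \<in> B" "{a, b} \<in> edges G"
      by (auto simp: quotient_graph_def)
    then obtain a b where ab: "a \<in> rel_block G R x" "b \<in> rel_block G R y" "{a, b} \<in> edges G"
      by (metis doubleton_eq_iff insert_commute)
    then obtain \<phi> where \<phi>: "\<phi> \<in> edges G // R" "{a, b} \<in> \<phi>"
      using Union_quotient[OF equiv_R] by blast
    have eq: "off_component G \<psi> x = off_component G \<psi> a"
      "off_component G \<psi> y = off_component G \<psi> b" if "\<psi> \<in> edges G // R" for \<psi>
      using ab that x y by (auto simp: mem_rel_block_iff)
    have "?F \<phi>"
      using edge_factor_iff[of a b \<phi>] \<phi> eq edge_verts[OF ab(3)] by auto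
    moreover have "?S \<phi>"
      using step[OF \<phi>(2,1)] eq by auto
    ultimately show "\<exists>\<phi>\<in>edges G // R. ?F \<phi> \<and> ?S \<phi>"
      using \<phi> by blast
  next
    assume "\<exists>\<phi>\<in>edges G // R. ?F \<phi> \<and> ?S \<phi>"
    then obtain \<phi> z where \<phi>: "\<phi> \<in> edges G // R" "?S \<phi>" and xz: "{x, z} \<in> \<phi>"
      and yz: "off_component G \<phi> y = off_component G \<phi> z"
      using edge_factor_iff[OF x y] by blast
    have xzG: "{x, z} \<in> edges G"
      using xz \<phi> class_subset by blast
    \<comment> \<open>For \<open>\<psi> = \<phi>\<close> this is the choice of \<open>z\<close>;
      otherwise \<open>y\<close> and \<open>z\<close> both share the component of
      \<open>x\<close>.\<close>
    have "off_component G \<psi> y = off_component G \<psi> z" if "\<psi> \<in> edges G // R" for \<psi>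
      using step[OF xz \<phi>(1), of \<psi>] \<phi>(2) yz that by (cases "\<psi> = \<phi>") auto
    then have "z \<in> rel_block G R y" "x \<in> rel_block G R x"
      using x y edge_verts[OF xzG] by (auto simp: mem_rel_block_iff)
    then show ?E
      using x y xzG by (auto simp: quotient_graph_def rel_partition_def)
  qed
qed

end

section \<open>The isomorphism\<close>

theorem mainTheorem2:
  fixes G :: "'a ugraph"
    and R :: "('a set \<times> 'a set) set"
    and \<phi>s :: "'a set set list"
  assumes "simple_graph G" and "finite (verts G)" and "connected_graph G"
    and "usp_relation G R"
    and "distinct \<phi>s" and "set \<phi>s = edges G // R"
  shows "quotient_graph G (rel_partition G R) \<cong>
         cart_prod_list
           (map (\<lambda>\<phi>. quotient_graph (spanning_subgraph G \<phi>) (class_partition G \<phi>)) \<phi>s)"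
proof -
  interpret usp_graph G R
    using assms by unfold_locales
  let ?X = "\<lambda>\<phi>. quotient_graph (spanning_subgraph G \<phi>) (class_partition G \<phi>)"
  let ?C = "\<lambda>x. map (\<lambda>\<phi>. off_component G \<phi> x) \<phi>s"
  \<comment> \<open>All members of a block have the same component for each class, so the union
    gives that component without choosing a representative.\<close>
  define h where "h A = map (\<lambda>\<phi>. \<Union>x\<in>A. off_component G \<phi> x) \<phi>s" for A
  have h: "h (rel_block G R x) = ?C x" if x: "x \<in> verts G" for x
  proof -
    have "(\<Union>y\<in>rel_block G R x. off_component G \<phi> y) = off_component G \<phi> x"
      if "\<phi> \<in> edges G // R" for \<phi>
    proof -
      have "x \<in> rel_block G R x"
        using x by (simp add: mem_rel_block_iff)
      moreover have "off_component G \<phi> y = off_component G \<phi> x" if "y \<in> rel_block G R x" for y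
        using that x \<open>\<phi> \<in> edges G // R\<close> by (simp add: mem_rel_block_iff)
      ultimately show ?thesis
        by blast
    qed
    then show ?thesis
      using assms(6) by (simp add: h_def)
  qed
  have vX: "verts (?X \<phi>) = off_component G \<phi> ` verts G" for \<phi>
    by (auto simp: quotient_graph_def class_partition_def off_component_def)
  have vG: "verts (quotient_graph G (rel_partition G R)) = rel_block G R ` verts G"
    by (auto simp: quotient_graph_def rel_partition_def)
  have "inj_on h (rel_block G R ` verts G)"
  proof (intro inj_onI; clarify)
    fix x y assume "x \<in> verts G" "y \<in> verts G" "h (rel_block G R x) = h (rel_block G R y)"
    then show "rel_block G R x = rel_block G R y"
      using assms(6) by (auto simp: h mem_rel_block_iff)
  qed
  moreover have "h ` rel_block G R ` verts G = verts (cart_prod_list (map ?X \<phi>s))"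
  proof (intro equalityI subsetI)
    fix Cs assume "Cs \<in> verts (cart_prod_list (map ?X \<phi>s))"
    then have len: "length Cs = length \<phi>s"
      and "\<forall>i<length \<phi>s. \<exists>x\<in>verts G. Cs ! i = off_component G (\<phi>s ! i) x"
      by (auto simp: verts_cart_prod_list list_all2_conv_all_nth vX image_iff)
    then obtain x where x: "\<And>i. i < length \<phi>s \<Longrightarrow> x i \<in> verts G"
      "\<And>i. i < length \<phi>s \<Longrightarrow> Cs ! i = off_component G (\<phi>s ! i) (x i)"
      by metis
    \<comment> \<open>The vertices were chosen by position, but \<open>common_vertex\<close> takes
      them by class; distinctness of \<open>\<phi>s\<close> makes the position recoverable.\<close>
    define x' where "x' \<phi> = x (THE i. i < length \<phi>s \<and> \<phi>s ! i = \<phi>)" for \<phi>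
    have x': "x' (\<phi>s ! i) = x i" if "i < length \<phi>s" for i
    proof -
      have "(THE j. j < length \<phi>s \<and> \<phi>s ! j = \<phi>s ! i) = i"
        using that assms(5) by (auto simp: nth_eq_iff_index_eq)
      then show ?thesis by (simp add: x'_def)
    qed
    then have "\<And>\<phi>. \<phi> \<in> set \<phi>s \<Longrightarrow> x' \<phi> \<in> verts G"
      using x(1) by (auto simp: in_set_conv_nth)
    then obtain w where w: "w \<in> verts G" "\<forall>\<phi>\<in>set \<phi>s. (x' \<phi>, w) \<in> (off_class G \<phi>)\<^sup>*"
      using common_vertex[of \<phi>s x'] assms(5,6) by auto
    have "Cs = ?C w"
    proof (rule nth_equalityI)
      fix i assume "i < length Cs"
      then have i: "i < length \<phi>s"
        by (simp add: len)
      then have "(x i, w) \<in> (off_class G (\<phi>s ! i))\<^sup>*"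
        using bspec[OF w(2) nth_mem[OF i]] x'[OF i] by simp
      then have "off_component G (\<phi>s ! i) (x i) = off_component G (\<phi>s ! i) w"
        using off_component_eq_iff[OF x(1)[OF i] w(1)] by simp
      then show "Cs ! i = ?C w ! i"
        using x(2)[OF i] i by simp
    qed (simp add: len)
    then show "Cs \<in> h ` rel_block G R ` verts G"
      using w(1) h by (metis imageI)
  qed (auto simp: h verts_cart_prod_list list_all2_conv_all_nth vX)
  \<comment> \<open>Both sides reduce to one condition: adjacent components for one class and equal
    components for all others.\<close>
  moreover have "{rel_block G R x, rel_block G R y} \<in> edges (quotient_graph G (rel_partition G R))
      \<longleftrightarrow> {h (rel_block G R x), h (rel_block G R y)} \<in> edges (cart_prod_list (map ?X \<phi>s))"
    if "x \<in> verts G" "y \<in> verts G" for x y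
    using that assms(5,6) by (simp add: edge_rel_partition_iff h edge_cart_prod_list_map_iff vX)
  ultimately show ?thesis
    unfolding graph_iso_def bij_betw_def vG by blast
qed

end
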